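(* Let $A\in\mathcal{PC}_n$ and let $w\in\mathcal{V}_n$ be the Perron vector of $A$. Suppose that $A(n)$ is inconsistent. If $w(n)$ is the Perron vector of $A(n)$, then $w$ is inefficient for $A$ and $n$ is a sink vertex of the digraph $G(A,w)$.
   Context: $n\ge 2$. $\mathcal{PC}_n$ denotes the set of $n\times n$ reciprocal matrices, i.e. real matrices $A=[a_{ij}]$ with all entries positive and $a_{ji}=1/a_{ij}$ for all $i,j$ (so $a_{ii}=1$). $\mathcal{V}_n$ is the set of entrywise positive real $n$-vectors. A reciprocal matrix $A$ is consistent if $a_{ij}a_{jk}=a_{ik}$ for all $i,j,k$, and inconsistent otherwise. The Perron vector of a positive square matrix is any entrywise positive (right) eigenvector (unique up to positive scalar multiple). $A(n)$ is the principal submatrix of $A$ obtained by deleting row and column $n$, and $w(n)$ is the vector obtained from $w$ by deleting its $n$th entry. A vector $w\in\mathcal{V}_n$ is efficient for $A\in\mathcal{PC}_n$ if, for every $v\in\mathcal{V}_n$, the inequalities $|a_{ij}-v_i/v_j|\le|a_{ij}-w_i/w_j|$ for all $i,j$ imply that $v$ is a positive scalar multiple of $w$; otherwise it is inefficient. $G(A,w)$ is the digraph with vertex set $\{1,\ldots,n\}$ and a directed edge $i\to j$ ($i\ne j$) if and only if $w_i/w_j\ge a_{ij}$. A sink vertex is a vertex with outdegree $0$. *)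

theory Defs
  imports
    "Jordan_Normal_Form.Determinant"
    "Jordan_Normal_Form.Char_Poly"
    "Graph_Theory.Digraph"
begin

text \<open>
  All indices are 0-based: the row, column, entry or vertex usually numbered \<open>i \<in> {1, \<dots>, n}\<close>
  is here numbered \<open>i - 1 \<in> {0..<n}\<close>.
\<close>

definition reciprocal_mats :: "nat \<Rightarrow> real mat set" where
  "reciprocal_mats n =
    {A \<in> carrier_mat n n. \<forall>i<n. \<forall>j<n. A $$ (i, j) > 0 \<and> A $$ (j, i) = 1 / A $$ (i, j)}"

definition positive_vecs :: "nat \<Rightarrow> real vec set" where
  "positive_vecs n = {v \<in> carrier_vec n. \<forall>i<n. v $ i > 0}"

definition consistent :: "real mat \<Rightarrow> bool" where
  "consistent A \<longleftrightarrow>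
    (\<forall>i<dim_row A. \<forall>j<dim_row A. \<forall>k<dim_row A. A $$ (i, j) * A $$ (j, k) = A $$ (i, k))"

text \<open>The Perron vector of a positive matrix is determined only up to positive scaling, so it is
  a predicate here.\<close>

definition perron_vector :: "real mat \<Rightarrow> real vec \<Rightarrow> bool" where
  "perron_vector A w \<longleftrightarrow> w \<in> positive_vecs (dim_row A) \<and> (\<exists>r. eigenvector A w r)"

text \<open>The vector analogue of \<^const>\<open>mat_delete\<close>.\<close>

definition vec_delete :: "'a vec \<Rightarrow> nat \<Rightarrow> 'a vec" where
  "vec_delete w k = vec (dim_vec w - 1) (\<lambda>i. w $ (if i < k then i else Suc i))"

definition efficient :: "real mat \<Rightarrow> real vec \<Rightarrow> bool" where
  "efficient A w \<longleftrightarrow>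
    (\<forall>v \<in> positive_vecs (dim_row A).
      (\<forall>i<dim_row A. \<forall>j<dim_row A.
        \<bar>A $$ (i, j) - v $ i / v $ j\<bar> \<le> \<bar>A $$ (i, j) - w $ i / w $ j\<bar>) \<longrightarrow>
      (\<exists>c>0. v = c \<cdot>\<^sub>v w))"

definition comparison_digraph :: "real mat \<Rightarrow> real vec \<Rightarrow> (nat, nat \<times> nat) pre_digraph" where
  "comparison_digraph A w =
    \<lparr>verts = {0..<dim_row A},
     arcs = {(i, j). i < dim_row A \<and> j < dim_row A \<and> i \<noteq> j \<and> w $ i / w $ j \<ge> A $$ (i, j)},
     tail = fst, head = snd\<rparr>"

lemma digraph_comparison_digraph: "digraph (comparison_digraph A w)"
proof
  show "finite (arcs (comparison_digraph A w))"
    by (rule finite_subset[of _ "{0..<dim_row A} \<times> {0..<dim_row A}"])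
      (auto simp: comparison_digraph_def)
qed (auto simp: comparison_digraph_def arc_to_ends_def)

definition sink_vertex :: "('a, 'b) pre_digraph \<Rightarrow> 'a \<Rightarrow> bool" where
  "sink_vertex G x \<longleftrightarrow> x \<in> verts G \<and> out_degree G x = 0"

end

theory Submission
  imports Defs
begin

text \<open>
  Put \<open>m = n - 1\<close>, and let \<open>r\<close> and \<open>r'\<close> be the Perron roots of \<open>A\<close> and of its leading block.
  Subtracting the eigenvalue equation of the block from the first \<open>m\<close> rows of that of \<open>A\<close> leaves
  only the last column: \<open>a\<^sub>i\<^sub>m w\<^sub>m = s w\<^sub>i\<close> with \<open>s = r - r'\<close>. So the last column of \<open>A\<close> agrees with
  the ratios \<open>w\<^sub>i / w\<^sub>m\<close> up to one common factor \<open>s\<close>, and everything depends on the position of \<open>s\<close>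
  relative to 1.

  By reciprocity the last row is \<open>a\<^sub>m\<^sub>j = w\<^sub>m / (s w\<^sub>j)\<close>, so the last eigenvalue equation says
  \<open>m / s + 1 = r = r' + s\<close>. An inconsistent reciprocal matrix of order \<open>m\<close> has Perron root greater
  than \<open>m\<close> (\<open>perron_root_gt_order\<close>, an instance of \<open>x + 1 / x \<ge> 2\<close>), and \<open>m / s + 1 > m + s\<close> forces
  \<open>s < 1\<close>. Hence \<open>a\<^sub>m\<^sub>j > w\<^sub>m / w\<^sub>j\<close> for every \<open>j < m\<close>, so no arc leaves the last vertex. Moreover
  replacing \<open>w\<^sub>m\<close> by \<open>w\<^sub>m / s\<close> makes the approximation exact in the last row and column without
  affecting any other entry (\<open>proportional_column_not_efficient\<close>), so \<open>w\<close> is inefficient.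
\<close>

section \<open>Reciprocal matrices and eigenvalue equations\<close>

lemma reciprocal_matsD:
  assumes "A \<in> reciprocal_mats n" "i < n" "j < n"
  shows "A $$ (i, j) > 0" and "A $$ (j, i) = 1 / A $$ (i, j)"
  using assms unfolding reciprocal_mats_def by blast+

lemma reciprocal_mats_carrier:
  assumes "A \<in> reciprocal_mats n"
  shows "A \<in> carrier_mat n n"
  using assms unfolding reciprocal_mats_def by blast

lemma reciprocal_mats_diag:
  assumes "A \<in> reciprocal_mats n" "i < n"
  shows "A $$ (i, i) = 1"
proof -
  have "A $$ (i, i) * A $$ (i, i) = 1"
    using reciprocal_matsD[OF assms assms(2)] by (simp add: field_simps)
  then show ?thesis
    using reciprocal_matsD(1)[OF assms assms(2)] by (simp add: square_eq_1_iff)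
qed

lemma eigenvector_row_sum:
  fixes A :: "'a :: comm_ring_1 mat"
  assumes "A \<in> carrier_mat n n" "eigenvector A w r" "i < n"
  shows "(\<Sum>j<n. A $$ (i, j) * w $ j) = r * w $ i"
proof -
  have w: "dim_vec w = n" and "A *\<^sub>v w = r \<cdot>\<^sub>v w"
    using assms(1,2) by (simp_all add: eigenvector_def)
  then have "(A *\<^sub>v w) $ i = r * w $ i"
    using assms(3) by simp
  moreover have "(A *\<^sub>v w) $ i = (\<Sum>j<n. A $$ (i, j) * w $ j)"
    using assms(1,3) w by (simp add: scalar_prod_def atLeast0LessThan)
  ultimately show ?thesis
    by simp
qed

section \<open>The Perron root of an inconsistent reciprocal matrix\<close>

lemma add_inverse_ge_2:
  fixes x :: real
  assumes "x > 0"
  shows "x + 1 / x \<ge> 2" and "x \<noteq> 1 \<Longrightarrow> x + 1 / x > 2"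
proof -
  have eq: "x + 1 / x - 2 = (x - 1)\<^sup>2 / x"
    using assms by (simp add: field_simps power2_eq_square)
  have "(x - 1)\<^sup>2 / x \<ge> 0"
    using assms by simp
  with eq show "x + 1 / x \<ge> 2"
    by linarith
  assume "x \<noteq> 1"
  then have "(x - 1)\<^sup>2 / x > 0"
    using assms by simp
  with eq show "x + 1 / x > 2"
    by linarith
qed

text \<open>
  The numbers \<open>c i j = a\<^sub>i\<^sub>j w\<^sub>j / w\<^sub>i\<close> again satisfy \<open>c j i = 1 / c i j\<close>, and each of their rows sums
  to \<open>r\<close>. Their total \<open>n r\<close> is at least \<open>n\<^sup>2\<close> by pairing \<open>c i j\<close> with \<open>c j i\<close>, with equality only if
  every \<open>c i j\<close> is 1, that is, \<open>a\<^sub>i\<^sub>j = w\<^sub>i / w\<^sub>j\<close>, which is consistent.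
\<close>

lemma perron_root_gt_order:
  assumes A: "A \<in> reciprocal_mats n" and w: "w \<in> positive_vecs n"
    and ev: "eigenvector A w r" and incons: "\<not> consistent A"
  shows "r > real n"
proof -
  define c where "c i j = A $$ (i, j) * w $ j / w $ i" for i j
  have carr: "A \<in> carrier_mat n n"
    by (rule reciprocal_mats_carrier[OF A])
  have wpos: "w $ i > 0" if "i < n" for i
    using w that by (simp add: positive_vecs_def)
  have cpos: "c i j > 0" and cinv: "c j i = 1 / c i j" if "i < n" "j < n" for i j
    using reciprocal_matsD[OF A that] wpos[OF that(1)] wpos[OF that(2)]
    by (simp_all add: c_def)
  have row: "(\<Sum>j<n. c i j) = r" if "i < n" for i
  proof -
    have "(\<Sum>j<n. c i j) = (\<Sum>j<n. A $$ (i, j) * w $ j) / w $ i"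
      by (simp add: c_def sum_divide_distrib)
    then show ?thesis
      using eigenvector_row_sum[OF carr ev that] wpos[OF that] by simp
  qed
  have "\<exists>i<n. \<exists>j<n. c i j \<noteq> 1"
  proof (rule ccontr)
    assume "\<not> ?thesis"
    then have one: "c i j = 1" if "i < n" "j < n" for i j
      using that by blast
    have ratio: "A $$ (i, j) = w $ i / w $ j" if "i < n" "j < n" for i j
      using one[OF that] wpos[OF that(1)] wpos[OF that(2)] by (simp add: c_def field_simps)
    have "consistent A"
      unfolding consistent_def using carr by (simp add: ratio wpos less_imp_neq[THEN not_sym])
    with incons show False ..
  qed
  then obtain p q where pq: "p < n" "q < n" "c p q \<noteq> 1"
    by blast
  have ge: "2 \<le> c i j + c j i" if "i < n" "j < n" for i j
    using add_inverse_ge_2(1)[OF cpos[OF that]] cinv[OF that] by simp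
  have "2 < c p q + c q p"
    using add_inverse_ge_2(2)[OF cpos[OF pq(1,2)] pq(3)] cinv[OF pq(1,2)] by simp
  then have strict: "(\<Sum>j<n. 2) < (\<Sum>j<n. c p j + c j p)"
    using ge pq by (intro sum_strict_mono_ex1 ballI bexI[of _ q]) auto
  have "(\<Sum>i<n. \<Sum>j<n. 2) < (\<Sum>i<n. \<Sum>j<n. c i j + c j i)"
  proof (rule sum_strict_mono_ex1)
    show "\<forall>i\<in>{..<n}. (\<Sum>j<n. 2) \<le> (\<Sum>j<n. c i j + c j i)"
      using ge by (intro ballI sum_mono) simp
    show "\<exists>i\<in>{..<n}. (\<Sum>j<n. 2) < (\<Sum>j<n. c i j + c j i)"
      using strict pq(1) by blast
  qed simp
  also have "\<dots> = (\<Sum>i<n. \<Sum>j<n. c i j) + (\<Sum>i<n. \<Sum>j<n. c j i)"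
    by (simp add: sum.distrib)
  also have "(\<Sum>i<n. \<Sum>j<n. c j i) = (\<Sum>i<n. \<Sum>j<n. c i j)"
    by (rule sum.swap)
  also have "(\<Sum>i<n. \<Sum>j<n. c i j) = real n * r"
    by (simp add: row)
  finally have "real n * real n < real n * r"
    by (simp add: mult.commute)
  then show ?thesis
    using pq(1) by simp
qed

section \<open>Improving a vector in one entry\<close>

text \<open>
  Dividing the entry \<open>w\<^sub>k\<close> by \<open>s\<close> brings the errors in row and column \<open>k\<close> to 0 and leaves all other
  ratios as they are. A second index is required, since in order 1 this only rescales \<open>w\<close>.
\<close>

lemma proportional_column_not_efficient:
  assumes A: "A \<in> reciprocal_mats n" and w: "w \<in> positive_vecs n"
    and n: "n \<ge> 2" and k: "k < n" and s: "s > 0" "s \<noteq> 1"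
    and col: "\<And>i. i < n \<Longrightarrow> i \<noteq> k \<Longrightarrow> A $$ (i, k) = s * w $ i / w $ k"
  shows "\<not> efficient A w"
proof
  assume eff: "efficient A w"
  define v where "v = vec n (\<lambda>i. if i = k then w $ k / s else w $ i)"
  have dim: "dim_row A = n" "dim_vec w = n"
    using reciprocal_mats_carrier[OF A] w by (simp_all add: positive_vecs_def)
  have wpos: "w $ i > 0" if "i < n" for i
    using w that by (simp add: positive_vecs_def)
  have vpos: "v \<in> positive_vecs n"
    using wpos k s by (auto simp: v_def positive_vecs_def)
  have closer: "\<bar>A $$ (i, j) - v $ i / v $ j\<bar> \<le> \<bar>A $$ (i, j) - w $ i / w $ j\<bar>"
    if ij: "i < n" "j < n" for i j
  proof -
    consider "i = j" | "i \<noteq> k" "j \<noteq> k" | "i \<noteq> k" "j = k" | "i = k" "j \<noteq> k"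
      by blast
    then show ?thesis
    proof cases
      case 1
      then show ?thesis
        using ij wpos[OF ij(1)] wpos[OF k] s by (simp add: v_def)
    next
      case 2
      then show ?thesis
        using ij by (simp add: v_def)
    next
      case 3
      then have "A $$ (i, j) = v $ i / v $ j"
        using ij k s col[of i] by (simp add: v_def mult.commute)
      then show ?thesis
        by simp
    next
      case 4
      then have "A $$ (i, j) = v $ i / v $ j"
        using ij s col[of j] reciprocal_matsD(2)[OF A ij(2,1)] by (simp add: v_def)
      then show ?thesis
        by simp
    qed
  qed
  obtain t where t: "v = t \<cdot>\<^sub>v w"
    using eff vpos closer unfolding efficient_def dim by blast
  obtain i where i: "i < n" "i \<noteq> k"
  proof (cases "k = 0")
    case True
    then show thesis
      using n by (intro that[of 1]) auto
  next
    case False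
    then show thesis
      using k by (intro that[of 0]) auto
  qed
  have "v $ i = t * w $ i" "v $ k = t * w $ k"
    using t i k dim by simp_all
  then have "w $ i = t * w $ i" "w $ k / s = t * w $ k"
    using i k by (simp_all add: v_def)
  then show False
    using wpos[OF i(1)] wpos[OF k] s by (simp add: field_simps)
qed

section \<open>Perron vectors extending a Perron vector of the leading block\<close>

lemma mat_delete_last_reciprocal:
  assumes "A \<in> reciprocal_mats (Suc m)"
  shows "mat_delete A m m \<in> reciprocal_mats m"
    and "\<And>i j. i < m \<Longrightarrow> j < m \<Longrightarrow> mat_delete A m m $$ (i, j) = A $$ (i, j)"
proof -
  have A: "A \<in> carrier_mat (Suc m) (Suc m)"
    by (rule reciprocal_mats_carrier[OF assms])
  show entry: "mat_delete A m m $$ (i, j) = A $$ (i, j)" if "i < m" "j < m" for i j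
    using A that by (simp add: mat_delete_def)
  show "mat_delete A m m \<in> reciprocal_mats m"
    unfolding reciprocal_mats_def
  proof (intro CollectI conjI allI impI)
    show "mat_delete A m m \<in> carrier_mat m m"
      using A by (intro carrier_matI) (simp_all add: mat_delete_def)
    fix i j assume "i < m" "j < m"
    then show "mat_delete A m m $$ (i, j) > 0"
      and "mat_delete A m m $$ (j, i) = 1 / mat_delete A m m $$ (i, j)"
      using reciprocal_matsD[OF assms, of i j] by (simp_all add: entry)
  qed
qed

theorem corollary22:
  fixes n :: nat and A :: "real mat" and w :: "real vec"
  assumes "n \<ge> 2"
    and "A \<in> reciprocal_mats n"
    and "w \<in> positive_vecs n"
    and "perron_vector A w"
    and "\<not> consistent (mat_delete A (n - 1) (n - 1))"
    and "perron_vector (mat_delete A (n - 1) (n - 1)) (vec_delete w (n - 1))"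
  shows "\<not> efficient A w \<and> sink_vertex (comparison_digraph A w) (n - 1)"
proof -
  define m where "m = n - 1"
  have n: "n = Suc m" and m: "m \<ge> 1"
    using assms(1) by (auto simp: m_def)
  define B where "B = mat_delete A m m"
  define u where "u = vec_delete w m"
  note A = assms(2)[unfolded n]
  have carr: "A \<in> carrier_mat (Suc m) (Suc m)"
    by (rule reciprocal_mats_carrier[OF A])
  have B: "B \<in> reciprocal_mats m" "\<And>i j. i < m \<Longrightarrow> j < m \<Longrightarrow> B $$ (i, j) = A $$ (i, j)"
    using mat_delete_last_reciprocal[OF A] by (simp_all add: B_def)
  note carrB = reciprocal_mats_carrier[OF B(1)]
  have wpos: "w $ i > 0" if "i < Suc m" for i
    using assms(3) that n by (simp add: positive_vecs_def)
  have "dim_vec w = Suc m"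
    using assms(3) n by (simp add: positive_vecs_def)
  then have u: "u $ i = w $ i" if "i < m" for i
    using that by (simp add: u_def vec_delete_def)
  obtain r where r: "eigenvector A w r"
    using assms(4) by (auto simp: perron_vector_def)
  obtain r' where r': "eigenvector B u r'" and upos: "u \<in> positive_vecs m"
    using assms(6) carrB by (auto simp: perron_vector_def B_def u_def m_def)
  have "r' > real m"
    using perron_root_gt_order[OF B(1) upos r'] assms(5) by (simp add: B_def m_def)
  define s where "s = r - r'"
  have last_col: "A $$ (i, m) * w $ m = s * w $ i" if "i < m" for i
  proof -
    have "(\<Sum>j<m. A $$ (i, j) * w $ j) = r' * w $ i"
      using eigenvector_row_sum[OF carrB r' that] that by (simp add: B(2) u)
    then show ?thesis
      using eigenvector_row_sum[OF carr r, of i] that by (simp add: s_def algebra_simps)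
  qed
  have "s * w $ 0 > 0"
    using last_col[of 0, symmetric] m reciprocal_matsD(1)[OF A, of 0 m] wpos[of m] by simp
  then have spos: "s > 0"
    using wpos[of 0] by (simp add: zero_less_mult_iff)
  have last_row: "A $$ (m, j) * w $ j = w $ m / s" if "j < m" for j
  proof -
    have "A $$ (j, m) = s * w $ j / w $ m"
      using last_col[OF that] wpos[of m] by (simp add: field_simps)
    then show ?thesis
      using reciprocal_matsD(2)[OF A, of j m] that wpos[of j] by simp
  qed
  have "real m * (w $ m / s) + w $ m = r * w $ m"
    using eigenvector_row_sum[OF carr r, of m] reciprocal_mats_diag[OF A, of m]
    by (simp add: last_row)
  then have "(real m / s + 1) * w $ m = r * w $ m"
    by (simp add: algebra_simps)
  then have root: "real m / s + 1 = r"
    using wpos[of m] by simp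
  have "s < 1"
  proof (rule ccontr)
    assume "\<not> s < 1"
    then have "real m / s \<le> real m"
      using spos by (simp add: divide_le_eq mult_le_cancel_left1)
    then show False
      using root \<open>r' > real m\<close> \<open>\<not> s < 1\<close> by (simp add: s_def)
  qed
  have "\<not> efficient A w"
  proof (rule proportional_column_not_efficient[OF assms(2,3,1)])
    show "m < n" "s > 0" "s \<noteq> 1"
      using n spos \<open>s < 1\<close> by auto
    show "A $$ (i, m) = s * w $ i / w $ m" if "i < n" "i \<noteq> m" for i
      using last_col[of i] that n wpos[of m] by (simp add: field_simps)
  qed
  moreover have "sink_vertex (comparison_digraph A w) m"
  proof -
    have "\<not> w $ m / w $ j \<ge> A $$ (m, j)" if "j < m" for j
    proof -
      have "w $ m < w $ m / s"
        using spos \<open>s < 1\<close> wpos[of m] by (simp add: less_divide_eq)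
      then show ?thesis
        using last_row[OF that] wpos[of j] that by (simp add: not_le pos_divide_less_eq)
    qed
    then have "out_arcs (comparison_digraph A w) m = {}"
      using carr by (auto simp: out_arcs_def comparison_digraph_def less_Suc_eq)
    then show ?thesis
      using carr by (simp add: sink_vertex_def out_degree_def comparison_digraph_def)
  qed
  ultimately show ?thesis
    by (simp add: m_def)
qed

end
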